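(* Let $d\ge 2$ and $1\le p\le d-1$ be integers, and let $(Y_1,\ldots,Y_d)$ be a random vector with almost surely positive components such that $$\mathbb{P}(Y_1\le t_1,\ldots,Y_d\le t_d)\ \ge\ \mathbb{P}(Y_1\le t_1,\ldots,Y_p\le t_p)\,\mathbb{P}(Y_{p+1}\le t_{p+1},\ldots,Y_d\le t_d)$$ for all $t_1,\ldots,t_d>0$. Then $$\mathbb{E}\Big(\prod_{j=1}^dY_j^{-n_j}\Big)\ \ge\ \mathbb{E}\Big(\prod_{j=1}^pY_j^{-n_j}\Big)\cdot\mathbb{E}\Big(\prod_{j=p+1}^dY_j^{-n_j}\Big)$$ for all real $n_1,\ldots,n_d>0$ such that these three expectations exist (i.e., are finite). *)

theory Defs
  imports "HOL-Probability.Probability"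
begin

end

theory Submission
  imports Defs
begin

text \<open>
  For \<open>y > 0\<close> one has the layer-cake formula that \<open>y powr (- n)\<close> is the integral of
  \<open>n * t powr (- n - 1)\<close> over \<open>t \<ge> y\<close>. So the indicators of \<open>Y j \<le> t j\<close> in the
  hypothesis can be turned into the powers \<open>Y j powr (- n j)\<close> one coordinate at a time, by
  integrating both sides against the weight: in the product only the factor whose
  block contains that coordinate depends on \<open>t j\<close>, so the product form survives.
\<close>

text \<open>The cutoff to \<open>t > 0\<close> confines the integration to positive thresholds, the
  only ones for which the hypothesis on distribution functions is available.\<close>

definition powr_weight :: "real \<Rightarrow> real \<Rightarrow> ennreal" where
  "powr_weight n t = ennreal (n * t powr (- n - 1)) * indicator {0<..} t"

lemma powr_weight_measurable [measurable]: "powr_weight n \<in> borel_measurable borel"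
  unfolding powr_weight_def by measurable

lemma nn_integral_powr_weight:
  assumes "0 < y" "0 < n"
  shows "(\<integral>\<^sup>+t. powr_weight n t * indicator {..t} y \<partial>lborel) = ennreal (y powr (- n))"
proof -
  have "(\<integral>\<^sup>+t. powr_weight n t * indicator {..t} y \<partial>lborel)
      = (\<integral>\<^sup>+t. ennreal (n * t powr (- n - 1)) * indicator {y..} t \<partial>lborel)"
    using assms by (intro nn_integral_cong) (auto simp: powr_weight_def indicator_def)
  \<comment> \<open>The antiderivative is \<open>- (t powr (- n))\<close>; the \<open>0\<close> is
    its limit at infinity.\<close>
  also have "\<dots> = ennreal (0 - (- (y powr (- n))))"
  proof (rule nn_integral_FTC_atLeast)
    show "((\<lambda>t. - (t powr (- n))) has_real_derivative n * t powr (- n - 1)) (at t)" if "y \<le> t" for t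
      using assms that by (auto intro!: derivative_eq_intros)
    have "((\<lambda>t. t powr (- n)) \<longlongrightarrow> 0) at_top"
      using assms by (intro tendsto_neg_powr filterlim_ident) auto
    then show "((\<lambda>t. - (t powr (- n))) \<longlongrightarrow> 0) at_top"
      using tendsto_minus by fastforce
  qed (use assms in auto)
  finally show ?thesis by simp
qed

text \<open>Insert the layer-cake formula for \<open>X \<omega>\<close>, valid almost everywhere by
  positivity, and swap the integrals by Tonelli. The function \<open>g\<close> stands for the
  remaining factors of a product, which do not involve the threshold \<open>t\<close>.\<close>

lemma (in sigma_finite_measure) nn_integral_mult_powr_layer:
  fixes g :: "'a \<Rightarrow> ennreal" and X :: "'a \<Rightarrow> real"
  assumes [measurable]: "g \<in> borel_measurable M" "X \<in> borel_measurable M"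
    and pos: "AE \<omega> in M. X \<omega> > 0" and "0 < n"
  shows "(\<integral>\<^sup>+\<omega>. ennreal (X \<omega> powr (- n)) * g \<omega> \<partial>M)
       = (\<integral>\<^sup>+t. powr_weight n t * (\<integral>\<^sup>+\<omega>. indicator {..t} (X \<omega>) * g \<omega> \<partial>M) \<partial>lborel)"
proof -
  interpret pair_sigma_finite M lborel ..
  \<comment> \<open>The set \<open>{..t}\<close> varies with the integration variable; as a
    comparison of \<open>x\<close> and \<open>t\<close>, the indicator is visibly jointly
    measurable.\<close>
  have ind: "indicator {..t} x = (if x \<le> t then 1 else 0 :: ennreal)" for x t :: real
    by simp
  have "(\<integral>\<^sup>+\<omega>. ennreal (X \<omega> powr (- n)) * g \<omega> \<partial>M)
      = (\<integral>\<^sup>+\<omega>. (\<integral>\<^sup>+t. powr_weight n t * indicator {..t} (X \<omega>) * g \<omega> \<partial>lborel) \<partial>M)"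
    using pos
  proof (intro nn_integral_cong_AE, eventually_elim)
    case (elim \<omega>)
    have "(\<integral>\<^sup>+t. powr_weight n t * indicator {..t} (X \<omega>) * g \<omega> \<partial>lborel)
        = (\<integral>\<^sup>+t. powr_weight n t * indicator {..t} (X \<omega>) \<partial>lborel) * g \<omega>"
      unfolding ind by (rule nn_integral_multc) measurable
    then show ?case
      using nn_integral_powr_weight \<open>0 < X \<omega>\<close> \<open>0 < n\<close> by simp
  qed
  also have "\<dots> = (\<integral>\<^sup>+t. (\<integral>\<^sup>+\<omega>. powr_weight n t * indicator {..t} (X \<omega>) * g \<omega> \<partial>M) \<partial>lborel)"
    unfolding ind by (rule Fubini'[symmetric]) measurable
  also have "\<dots> = (\<integral>\<^sup>+t. powr_weight n t * (\<integral>\<^sup>+\<omega>. indicator {..t} (X \<omega>) * g \<omega> \<partial>M) \<partial>lborel)"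
    by (intro nn_integral_cong) (simp add: nn_integral_cmult mult.assoc)
  finally show ?thesis .
qed

text \<open>Induction on the set of coordinates already turned from indicators into powers. Values
  in \<open>ennreal\<close> let the mixed integrals along the way be infinite.\<close>

lemma (in sigma_finite_measure) nn_integral_prod_powr_supermultiplicative:
  fixes Y :: "'i \<Rightarrow> 'a \<Rightarrow> real" and n :: "'i \<Rightarrow> real"
  assumes fin: "finite I" "finite J" and disj: "I \<inter> J = {}"
    and Y: "\<And>j. j \<in> I \<union> J \<Longrightarrow> Y j \<in> borel_measurable M"
    and pos: "\<And>j. j \<in> I \<union> J \<Longrightarrow> AE \<omega> in M. Y j \<omega> > 0"
    and n: "\<And>j. j \<in> I \<union> J \<Longrightarrow> n j > 0"
    and le: "\<And>t. (\<And>j. j \<in> I \<union> J \<Longrightarrow> t j > 0) \<Longrightarrow>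
      emeasure M {\<omega>\<in>space M. \<forall>j\<in>I. Y j \<omega> \<le> t j} * emeasure M {\<omega>\<in>space M. \<forall>j\<in>J. Y j \<omega> \<le> t j}
        \<le> emeasure M {\<omega>\<in>space M. \<forall>j\<in>I \<union> J. Y j \<omega> \<le> t j}"
  shows "(\<integral>\<^sup>+\<omega>. (\<Prod>j\<in>I. ennreal (Y j \<omega> powr (- n j))) \<partial>M)
      * (\<integral>\<^sup>+\<omega>. (\<Prod>j\<in>J. ennreal (Y j \<omega> powr (- n j))) \<partial>M)
    \<le> (\<integral>\<^sup>+\<omega>. (\<Prod>j\<in>I \<union> J. ennreal (Y j \<omega> powr (- n j))) \<partial>M)"
proof -
  \<comment> \<open>Hybrid factors: powers on \<open>S\<close>, indicators elsewhere. Thus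
    \<open>A S t K\<close> runs from a joint probability at \<open>S = {}\<close> to a negative
    moment once \<open>S\<close> contains \<open>K\<close>.\<close>
  define f where "f S t j \<omega> =
    (if j \<in> S then ennreal (Y j \<omega> powr (- n j)) else indicator {..t j} (Y j \<omega>))" for S t j \<omega>
  define A where "A S t K = (\<integral>\<^sup>+\<omega>. (\<Prod>j\<in>K. f S t j \<omega>) \<partial>M)" for S t K
  have f_meas: "f S t j \<in> borel_measurable M" if "j \<in> I \<union> J" for S t j
    using Y[OF that] unfolding f_def by (cases "j \<in> S") simp_all
  \<comment> \<open>A block without \<open>k\<close> sees neither the conversion of \<open>k\<close>
    nor its threshold.\<close>
  have A_notin: "A (insert k S) t K = A S t K" "A S (t(k := s)) K = A S t K" if "k \<notin> K" for k S t s K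
    using that unfolding A_def f_def
    by (intro nn_integral_cong prod.cong; auto)+
  have A_insert: "A (insert k S) t K = (\<integral>\<^sup>+s. powr_weight (n k) s * A S (t(k := s)) K \<partial>lborel)"
    if K: "k \<in> K" "K \<subseteq> I \<union> J" and "k \<notin> S" for k S t K
  proof -
    have "finite K" using K(2) fin finite_subset by blast
    \<comment> \<open>The factors other than \<open>k\<close> are the same before and after the
      conversion, and independent of \<open>s\<close>.\<close>
    define g where "g \<omega> = (\<Prod>j\<in>K - {k}. f S t j \<omega>)" for \<omega>
    have "g \<in> borel_measurable M"
      unfolding g_def using f_meas K(2) by (intro borel_measurable_prod_ennreal) auto
    moreover have "(\<Prod>j\<in>K. f (insert k S) t j \<omega>) = ennreal (Y k \<omega> powr (- n k)) * g \<omega>" for \<omega>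
      unfolding g_def prod.remove[OF \<open>finite K\<close> K(1)]
      by (intro arg_cong2[where f = "(*)"] prod.cong) (auto simp: f_def)
    moreover have "(\<Prod>j\<in>K. f S (t(k := s)) j \<omega>) = indicator {..s} (Y k \<omega>) * g \<omega>" for s \<omega>
      unfolding g_def prod.remove[OF \<open>finite K\<close> K(1)]
      using \<open>k \<notin> S\<close> by (intro arg_cong2[where f = "(*)"] prod.cong) (auto simp: f_def)
    ultimately show ?thesis
      unfolding A_def using nn_integral_mult_powr_layer[of g "Y k" "n k"] Y pos n K by auto
  qed
  \<comment> \<open>Joint measurability in the threshold and \<omega> survives integrating out
    \<omega>. This is what later allows a constant factor to be moved into the integral over
    \<open>s\<close>.\<close>
  have A_meas: "(\<lambda>s. A S (t(k := s)) K) \<in> borel_measurable borel" if "K \<subseteq> I \<union> J" for k S t K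
  proof -
    have "(\<lambda>z. \<Prod>j\<in>K. f S (t(k := fst z)) j (snd z)) \<in> borel_measurable (borel \<Otimes>\<^sub>M M)"
    proof (intro borel_measurable_prod_ennreal)
      fix j assume "j \<in> K"
      then have [measurable]: "Y j \<in> borel_measurable M" using Y that by auto
      show "(\<lambda>z. f S (t(k := fst z)) j (snd z)) \<in> borel_measurable (borel \<Otimes>\<^sub>M M)"
        unfolding f_def indicator_def of_bool_def atMost_iff by (cases "k = j"; cases "j \<in> S"; simp)
    qed
    then show ?thesis
      unfolding A_def by (intro borel_measurable_nn_integral) (simp add: split_beta')
  qed
  \<comment> \<open>The thresholds \<open>t\<close> must stay general in the induction, since
    converting \<open>k\<close> calls for the inequality at every \<open>t(k := s)\<close> with
    \<open>s > 0\<close>.\<close>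
  have "A S t I * A S t J \<le> A S t (I \<union> J)" if "finite S" "S \<subseteq> I \<union> J" "\<And>j. j \<in> I \<union> J \<Longrightarrow> t j > 0" for S t
    using that
  proof (induction S arbitrary: t rule: finite_induct)
    case empty
    have "A {} t K = emeasure M {\<omega>\<in>space M. \<forall>j\<in>K. Y j \<omega> \<le> t j}" if "K \<subseteq> I \<union> J" for K
    proof -
      have [measurable]: "j \<in> K \<Longrightarrow> Y j \<in> borel_measurable M" for j using Y that by auto
      have finK: "finite K" using that fin finite_subset by blast
      have "A {} t K = (\<integral>\<^sup>+\<omega>. indicator {\<omega>\<in>space M. \<forall>j\<in>K. Y j \<omega> \<le> t j} \<omega> \<partial>M)"
        unfolding A_def f_def using finK
        by (intro nn_integral_cong) (auto simp: indicator_def prod_zero_iff)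
      also have "\<dots> = emeasure M {\<omega>\<in>space M. \<forall>j\<in>K. Y j \<omega> \<le> t j}"
        using finK by (intro nn_integral_indicator) measurable
      finally show ?thesis .
    qed
    then show ?case using le[of t] empty by simp
  next
    case (insert k S)
    \<comment> \<open>For \<open>s \<le> 0\<close> the induction hypothesis does not apply, but
      there the weight vanishes and both sides are zero.\<close>
    have IH: "powr_weight (n k) s * (A S (t(k := s)) I * A S (t(k := s)) J)
        \<le> powr_weight (n k) s * A S (t(k := s)) (I \<union> J)" for s
    proof (cases "s > 0")
      case True
      then show ?thesis using insert by (intro mult_left_mono insert.IH) auto
    qed (simp add: powr_weight_def)
    \<comment> \<open>Here \<open>L\<close> is the block containing \<open>k\<close> and
      \<open>L'\<close> the other one, so one argument serves both cases. The factor of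
      \<open>L'\<close> is constant in \<open>s\<close> and moves under the integral, where
      \<open>IH\<close> compares the integrands.\<close>
    have step: "A (insert k S) t L * A (insert k S) t L' \<le> A (insert k S) t (I \<union> J)"
      if L: "k \<in> L" "k \<notin> L'" "L \<subseteq> I \<union> J"
        and IH: "\<And>s. powr_weight (n k) s * (A S (t(k := s)) L * A S (t(k := s)) L')
            \<le> powr_weight (n k) s * A S (t(k := s)) (I \<union> J)" for L L'
    proof -
      have [measurable]: "(\<lambda>s. A S (t(k := s)) L) \<in> borel_measurable borel" using A_meas L by blast
      have "A (insert k S) t L * A (insert k S) t L'
          = (\<integral>\<^sup>+s. powr_weight (n k) s * A S (t(k := s)) L * A S t L' \<partial>lborel)"
        using L insert.hyps by (simp add: A_insert A_notin nn_integral_multc)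
      also have "\<dots> \<le> (\<integral>\<^sup>+s. powr_weight (n k) s * A S (t(k := s)) (I \<union> J) \<partial>lborel)"
        using IH L by (intro nn_integral_mono) (simp add: A_notin mult.assoc)
      also have "\<dots> = A (insert k S) t (I \<union> J)"
        using L insert.hyps by (subst A_insert) auto
      finally show ?thesis .
    qed
    show ?case
    proof (cases "k \<in> I")
      case True
      then show ?thesis using step[of I J] IH disj by auto
    next
      case False
      then show ?thesis using step[of J I] IH insert.prems by (auto simp: mult.commute)
    qed
  qed
  \<comment> \<open>With every coordinate converted no threshold is left, so any positive
    \<open>t\<close> will do.\<close>
  from this[of "I \<union> J" "\<lambda>_. 1"] have "A (I \<union> J) (\<lambda>_. 1) I * A (I \<union> J) (\<lambda>_. 1) J \<le> A (I \<union> J) (\<lambda>_. 1) (I \<union> J)"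
    using fin by simp
  then show ?thesis unfolding A_def f_def by simp
qed

theorem mainTheorem4:
  fixes M :: "'a measure" and Y :: "nat \<Rightarrow> 'a \<Rightarrow> real" and n :: "nat \<Rightarrow> real" and d p :: nat
  assumes "prob_space M"
    and "d \<ge> 2" and "1 \<le> p" and "p \<le> d - 1"
    and "\<And>j. j \<in> {1..d} \<Longrightarrow> Y j \<in> borel_measurable M"
    and "\<And>j. j \<in> {1..d} \<Longrightarrow> AE \<omega> in M. Y j \<omega> > 0"
    and "\<And>t :: nat \<Rightarrow> real. (\<And>j. j \<in> {1..d} \<Longrightarrow> t j > 0) \<Longrightarrow>
           \<P>(\<omega> in M. \<forall>j\<in>{1..d}. Y j \<omega> \<le> t j)
             \<ge> \<P>(\<omega> in M. \<forall>j\<in>{1..p}. Y j \<omega> \<le> t j) * \<P>(\<omega> in M. \<forall>j\<in>{p+1..d}. Y j \<omega> \<le> t j)"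
    and "\<And>j. j \<in> {1..d} \<Longrightarrow> n j > 0"
    and "integrable M (\<lambda>\<omega>. \<Prod>j\<in>{1..d}. Y j \<omega> powr (- n j))"
    and "integrable M (\<lambda>\<omega>. \<Prod>j\<in>{1..p}. Y j \<omega> powr (- n j))"
    and "integrable M (\<lambda>\<omega>. \<Prod>j\<in>{p+1..d}. Y j \<omega> powr (- n j))"
  shows "prob_space.expectation M (\<lambda>\<omega>. \<Prod>j\<in>{1..d}. Y j \<omega> powr (- n j))
           \<ge> prob_space.expectation M (\<lambda>\<omega>. \<Prod>j\<in>{1..p}. Y j \<omega> powr (- n j))
             * prob_space.expectation M (\<lambda>\<omega>. \<Prod>j\<in>{p+1..d}. Y j \<omega> powr (- n j))"
proof -
  interpret prob_space M by fact
  let ?I = "{1..p}" and ?J = "{p+1..d}"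
  have D: "{1..d} = ?I \<union> ?J" using assms(3,4) by auto
  define G where "G K \<omega> = (\<Prod>j\<in>K. Y j \<omega> powr (- n j))" for K \<omega>
  have nonneg: "0 \<le> G K \<omega>" for K \<omega> unfolding G_def by (simp add: prod_nonneg)
  \<comment> \<open>Integrability enters here: it identifies the \<open>ennreal\<close> integral
    with the real expectation, so the inequality can be carried back to the reals.\<close>
  have G: "(\<integral>\<^sup>+\<omega>. (\<Prod>j\<in>K. ennreal (Y j \<omega> powr (- n j))) \<partial>M) = ennreal (expectation (G K))"
    if "integrable M (G K)" for K
    using nn_integral_eq_integral[OF that] nonneg unfolding G_def by (simp add: prod_ennreal)
  have int: "integrable M (G (?I \<union> ?J))" "integrable M (G ?I)" "integrable M (G ?J)"
    using assms(9-11) unfolding G_def D by simp_all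
  have "(\<integral>\<^sup>+\<omega>. (\<Prod>j\<in>?I. ennreal (Y j \<omega> powr (- n j))) \<partial>M)
      * (\<integral>\<^sup>+\<omega>. (\<Prod>j\<in>?J. ennreal (Y j \<omega> powr (- n j))) \<partial>M)
    \<le> (\<integral>\<^sup>+\<omega>. (\<Prod>j\<in>?I \<union> ?J. ennreal (Y j \<omega> powr (- n j))) \<partial>M)"
  proof (rule nn_integral_prod_powr_supermultiplicative)
    fix t :: "nat \<Rightarrow> real" assume "\<And>j. j \<in> ?I \<union> ?J \<Longrightarrow> t j > 0"
    then show "emeasure M {\<omega>\<in>space M. \<forall>j\<in>?I. Y j \<omega> \<le> t j} * emeasure M {\<omega>\<in>space M. \<forall>j\<in>?J. Y j \<omega> \<le> t j}
        \<le> emeasure M {\<omega>\<in>space M. \<forall>j\<in>?I \<union> ?J. Y j \<omega> \<le> t j}"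
      using assms(7)[of t, unfolded D] by (simp add: emeasure_eq_measure flip: ennreal_mult)
  qed (use assms(5,6,8)[unfolded D] in auto)
  then have "expectation (G ?I) * expectation (G ?J) \<le> expectation (G (?I \<union> ?J))"
    unfolding int[THEN G] using nonneg by (simp flip: ennreal_mult)
  then show ?thesis unfolding D G_def .
qed

end
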